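(* Let $r\ge 2$ be an integer and let $G=(V,w)$ be an $\mathscr{F}_{2r+1}$-free coloured graph of order $n$ with $\delta(G)>\frac{6r-8}{3r-1}\,n$. Then there is a homomorphism from $G$ to $RK_r$; explicitly, there is a partition $V=W_1\cup\ldots\cup W_r$ into pairwise disjoint (possibly empty) sets such that all edges within the partition classes are green, i.e. $w(x,y)=0$ whenever $x,y$ belong to the same class $W_i$.
   Context: A coloured graph is a pair $G=(V,w)$, where $V$ is a finite set and $w\colon V^2\to\{0,1,2\}$ is a symmetric function with $w(x,x)=0$ for all $x\in V$. Its order is $|V|$ (taken to be at least $1$ when the minimum degree is considered). For distinct $x,y\in V$ the edge $xy$ is called green, blue, or red according to whether $w(x,y)$ is $0$, $1$, or $2$. The degree of $x\in V$ is $d(x)=\sum_{y\in V}w(x,y)$ and the minimum degree is $\delta(G)=\min\{d(v)\colon v\in V\}$. A coloured graph $G'=(V',w')$ is a subgraph of $G=(V,w)$ if $V'\subseteq V$ and $w'(x,y)\le w(x,y)$ for all $x,y\in V'$. Coloured graphs $(V,w)$, $(V',w')$ are isomorphic if there is a bijection $\varphi\colon V\to V'$ with $w(x,y)=w'(\varphi(x),\varphi(y))$ for all $x,y\in V$. $G$ is $F$-free if it has no subgraph isomorphic to $F$, and $\mathscr{F}$-free (for a set $\mathscr{F}$ of coloured graphs) if it is $F$-free for every $F\in\mathscr{F}$. A homomorphism from $(V,w)$ to $(V',w')$ is a map $\varphi\colon V\to V'$ such that $w(x,y)\le w'(\varphi(x),\varphi(y))$ for any two distinct $x,y\in V$. For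 $m\ge 0$, $RK_m$ and $BK_m$ denote the coloured graphs on $m$ vertices all of whose edges are red, respectively blue. For integers $a\ge b\ge 1$, $G_{a+b,b}$ is the coloured graph of order $a$ consisting of an $RK_b$ and a vertex-disjoint $BK_{a-b}$, with all edges between the two being blue. For every positive integer $t$, $\mathscr{F}_t=\{G_{t,i}\colon i \text{ an integer},\ 1\le i\le \frac t2\}$. *)

theory Defs
  imports Complex_Main "HOL-Library.Disjoint_Sets"
begin

text \<open>
  A coloured graph is a vertex set together with a weight function (0 green, 1 blue, 2 red).
  The weight function is total on the vertex type, but only its values on pairs of vertices matter:
  no notion below depends on the values elsewhere.
\<close>

type_synonym 'a cgraph = "'a set \<times> ('a \<Rightarrow> 'a \<Rightarrow> nat)"

abbreviation verts :: "'a cgraph \<Rightarrow> 'a set" where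
  "verts G \<equiv> fst G"

abbreviation weight :: "'a cgraph \<Rightarrow> 'a \<Rightarrow> 'a \<Rightarrow> nat" where
  "weight G \<equiv> snd G"

definition coloured_graph :: "'a cgraph \<Rightarrow> bool" where
  "coloured_graph G \<longleftrightarrow>
     finite (verts G) \<and>
     (\<forall>x\<in>verts G. \<forall>y\<in>verts G. weight G x y \<in> {0, 1, 2}) \<and>
     (\<forall>x\<in>verts G. \<forall>y\<in>verts G. weight G x y = weight G y x) \<and>
     (\<forall>x\<in>verts G. weight G x x = 0)"

definition degree :: "'a cgraph \<Rightarrow> 'a \<Rightarrow> nat" where
  "degree G x = (\<Sum>y\<in>verts G. weight G x y)"

text \<open>Only meaningful for coloured graphs with at least one vertex.\<close>

definition min_degree :: "'a cgraph \<Rightarrow> nat" where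
  "min_degree G = Min (degree G ` verts G)"

definition subgraph :: "'a cgraph \<Rightarrow> 'a cgraph \<Rightarrow> bool" where
  "subgraph H G \<longleftrightarrow>
     coloured_graph H \<and> coloured_graph G \<and> verts H \<subseteq> verts G \<and>
     (\<forall>x\<in>verts H. \<forall>y\<in>verts H. weight H x y \<le> weight G x y)"

definition isomorphic :: "'a cgraph \<Rightarrow> 'b cgraph \<Rightarrow> bool" where
  "isomorphic G H \<longleftrightarrow>
     (\<exists>\<phi>. bij_betw \<phi> (verts G) (verts H) \<and>
          (\<forall>x\<in>verts G. \<forall>y\<in>verts G. weight G x y = weight H (\<phi> x) (\<phi> y)))"

definition free_of :: "'a cgraph \<Rightarrow> 'b cgraph \<Rightarrow> bool" where
  "free_of G F \<longleftrightarrow> \<not> (\<exists>H. subgraph H G \<and> isomorphic H F)"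

definition family_free :: "'a cgraph \<Rightarrow> 'b cgraph set \<Rightarrow> bool" where
  "family_free G \<F> \<longleftrightarrow> (\<forall>F\<in>\<F>. free_of G F)"

definition homomorphism :: "('a \<Rightarrow> 'b) \<Rightarrow> 'a cgraph \<Rightarrow> 'b cgraph \<Rightarrow> bool" where
  "homomorphism \<phi> G H \<longleftrightarrow>
     \<phi> ` verts G \<subseteq> verts H \<and>
     (\<forall>x\<in>verts G. \<forall>y\<in>verts G. x \<noteq> y \<longrightarrow> weight G x y \<le> weight H (\<phi> x) (\<phi> y))"

definition RK :: "nat \<Rightarrow> nat cgraph" where
  "RK m = ({..<m}, \<lambda>x y. if x = y then 0 else 2)"

text \<open>
  \<open>G_graph t b\<close> is $G_{t,b}$. Writing $t = a + b$ with $a \ge b \ge 1$, it has order $a = t - b$;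
  the vertices below \<open>b\<close> form the red clique $RK_b$ and the remaining $a - b$ vertices the blue
  clique. It is used only for $1 \le b \le t/2$, so the subtraction does not truncate.
\<close>

definition G_graph :: "nat \<Rightarrow> nat \<Rightarrow> nat cgraph" where
  "G_graph t b = ({..<t - b}, \<lambda>x y. if x = y then 0 else if x < b \<and> y < b then 2 else 1)"

definition F_family :: "nat \<Rightarrow> nat cgraph set" where
  "F_family t = {G_graph t i | i. 1 \<le> i \<and> real i \<le> real t / 2}"

lemma coloured_graph_RK: "coloured_graph (RK m)"
  by (auto simp: coloured_graph_def RK_def)

lemma coloured_graph_G_graph: "coloured_graph (G_graph t b)"
  by (auto simp: coloured_graph_def G_graph_def)

end

theory Submission
  imports Defs
begin

text \<open>
  The graph of nongreen edges has minimum degree at least $\delta(G)/2 > \frac{3r-4}{3r-1}n$, so once it is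
  known to contain no clique of size $r+1$, the theorem of Andrasfai, Erdos and Sos colours it with $r$ colours.
  To exclude such cliques, take a nongreen clique $A$ of maximum size and, subject to this, with the fewest
  blue edges. Excluding $\mathscr{F}_{2r+1}$ means that $|A|+|B| \le 2r$ for every nonempty red clique
  $B \subseteq A$. Weighting the vertices of $A$ according to their blue degree inside $A$ and double
  counting the weighted degrees into $A$ contradicts the minimum degree condition.
  For the theorem of Andrasfai, Erdos and Sos itself, pass to an edge-maximal graph. If nonadjacency is not
  transitive there, then $xy$ is an edge and $xz$, $yz$ are not, for some $x, y, z$; maximality yields
  $(r-1)$-cliques $P$ and $Q$ in the common neighbourhoods of $x, z$ and of $y, z$. Choosing $|P \cap Q|$ as
  large as possible, every vertex has at least three nonneighbours among $P \cup \{x\}$, $Q \cup \{y\}$ and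
  $(P \cap Q) \cup \{z\}$, counted with multiplicity, and these sets have total size at most $3r-1$.
\<close>

section \<open>The theorem of Andrasfai, Erdos and Sos\<close>

text \<open>Nonadjacency is then an equivalence relation on \<open>V\<close>, and its classes serve
  as colour classes. Representatives of distinct classes are adjacent, so they form a clique and
  there are at most \<open>r\<close> classes.\<close>

lemma coloring_of_transitive_nonadjacency:
  assumes fin: "finite V" and sym: "sym E" and irr: "irrefl E"
    and free: "\<And>K. K \<subseteq> V \<Longrightarrow> pairwise (\<lambda>x y. (x, y) \<in> E) K \<Longrightarrow> card K \<le> r"
    and trans: "\<And>x y z. \<lbrakk>x \<in> V; y \<in> V; z \<in> V; (x, z) \<notin> E; (z, y) \<notin> E\<rbrakk> \<Longrightarrow> (x, y) \<notin> E"
  shows "\<exists>c::'a \<Rightarrow> nat. c ` V \<subseteq> {..<r} \<and> (\<forall>x\<in>V. \<forall>y\<in>V. (x, y) \<in> E \<longrightarrow> c x \<noteq> c y)"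
proof -
  define R where "R = {(x, y). x \<in> V \<and> y \<in> V \<and> (x, y) \<notin> E}"
  have R: "equiv V R"
  proof (rule equivI)
    show "R \<subseteq> V \<times> V" by (auto simp: R_def)
    show "refl_on V R" using irr by (auto simp: R_def refl_on_def irrefl_def)
    show "Relation.sym R" using sym by (auto simp: R_def sym_def)
    show "Relation.trans R" unfolding R_def trans_def using trans by blast
  qed
  have "\<forall>X\<in>V//R. \<exists>x. x \<in> X"
    using R equiv_Eps_in by blast
  then obtain f where f: "\<And>X. X \<in> V//R \<Longrightarrow> f X \<in> X" by metis
  have fV: "f X \<in> V" if "X \<in> V//R" for X
    using f[OF that] that R in_quotient_imp_subset by fastforce
  have f_adj: "(f X, f Y) \<in> E" if "X \<in> V//R" "Y \<in> V//R" "X \<noteq> Y" for X Y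
  proof (rule ccontr)
    assume "(f X, f Y) \<notin> E"
    then have "(f X, f Y) \<in> R" using fV that by (auto simp: R_def)
    then show False using quotient_eqI[OF R that(1,2) f f] that by blast
  qed
  have inj: "inj_on f (V//R)"
    using f_adj irr by (metis inj_onI irrefl_def)
  have "card (f ` (V//R)) \<le> r"
    using fV f_adj by (intro free) (auto simp: pairwise_def)
  then have "card (V//R) \<le> card {..<r}" using card_image[OF inj] by simp
  moreover have "finite (V//R)" using fin R finite_equiv_class
    by (metis equiv_def finite_quotient)
  ultimately obtain g where g: "g ` (V//R) \<subseteq> {..<r}" "inj_on g (V//R)"
    using card_le_inj[of "V//R" "{..<r}"] by auto
  show ?thesis
  proof (intro exI conjI ballI impI)
    show "(\<lambda>x. g (R``{x})) ` V \<subseteq> {..<r}"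
      using g(1) quotientI[of _ V R] by (auto simp: image_subset_iff)
    fix x y assume xy: "x \<in> V" "y \<in> V" "(x, y) \<in> E"
    then have "R``{x} \<noteq> R``{y}"
      using eq_equiv_class_iff[OF R xy(1,2)] by (simp add: R_def)
    then show "g (R``{x}) \<noteq> g (R``{y})"
      using inj_on_eq_iff[OF g(2) quotientI[OF xy(1)] quotientI[OF xy(2)]] by simp
  qed
qed

lemma sum_card_nonneighbours:
  assumes "finite V" "finite K"
  shows "(\<Sum>v\<in>V. card {u \<in> K. (u, v) \<notin> E}) = (\<Sum>u\<in>K. card {v \<in> V. (u, v) \<notin> E})"
  using sum.swap_restrict[OF assms, of "\<lambda>_ _. 1::nat" "\<lambda>v u. (u, v) \<notin> E"] by simp

text \<open>By \<open>deg\<close> each vertex has fewer than \<open>3 * card V / (3 * r - 1)\<close>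
  nonneighbours, itself included. Three sets of total size at most \<open>3 * r - 1\<close> thus see
  fewer than \<open>3 * card V\<close> nonadjacent pairs with \<open>V\<close>, while
  \<open>three\<close> demands three pairs for each vertex. The hypothesis \<open>sat\<close> is
  what edge-maximality provides.\<close>

lemma nonadjacency_transitive_of_saturated:
  assumes fin: "finite V" and sym: "sym E" and irr: "irrefl E"
    and free: "\<And>K. K \<subseteq> V \<Longrightarrow> pairwise (\<lambda>x y. (x, y) \<in> E) K \<Longrightarrow> card K \<le> r"
    and sat: "\<And>x y. \<lbrakk>x \<in> V; y \<in> V; x \<noteq> y; (x, y) \<notin> E\<rbrakk> \<Longrightarrow>
      \<exists>P\<subseteq>V. Suc (card P) = r \<and> pairwise (\<lambda>x y. (x, y) \<in> E) P \<and> (\<forall>p\<in>P. (p, x) \<in> E \<and> (p, y) \<in> E)"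
    and deg: "\<And>u. u \<in> V \<Longrightarrow> (3 * r - 1) * card {v \<in> V. (u, v) \<notin> E} < 3 * card V"
    and V: "x \<in> V" "y \<in> V" "z \<in> V" and nonadj: "(x, z) \<notin> E" "(z, y) \<notin> E"
  shows "(x, y) \<notin> E"
proof
  assume xy: "(x, y) \<in> E"
  have E_sym: "(u, v) \<in> E \<longleftrightarrow> (v, u) \<in> E" for u v
    using sym by (meson symE)
  have E_irr: "(u, u) \<notin> E" for u using irr by (simp add: irrefl_def)
  have neq: "x \<noteq> y" "x \<noteq> z" "y \<noteq> z" using xy nonadj E_irr E_sym by auto
  define \<P> where "\<P> u = {P. P \<subseteq> V \<and> Suc (card P) = r \<and> pairwise (\<lambda>x y. (x, y) \<in> E) P
    \<and> (\<forall>p\<in>P. (p, u) \<in> E \<and> (p, z) \<in> E)}" for u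
  obtain P0 Q0 where "P0 \<in> \<P> x" "Q0 \<in> \<P> y"
    using sat[of x z] sat[of y z] V neq nonadj E_sym by (auto simp: \<P>_def)
  moreover have "card (P \<inter> Q) \<le> card V" if "P \<in> \<P> x" for P Q
    using that fin by (intro card_mono) (auto simp: \<P>_def)
  ultimately have "\<exists>S. (fst S \<in> \<P> x \<and> snd S \<in> \<P> y) \<and>
      (\<forall>S'. fst S' \<in> \<P> x \<and> snd S' \<in> \<P> y \<longrightarrow> card (fst S' \<inter> snd S') \<le> card (fst S \<inter> snd S))"
    by (intro ex_has_greatest_nat[where k = "(P0, Q0)" and b = "Suc (card V)"]) (auto simp: less_Suc_eq_le)
  then obtain P Q where P: "P \<in> \<P> x" and Q: "Q \<in> \<P> y"
    and max: "\<And>P' Q'. P' \<in> \<P> x \<Longrightarrow> Q' \<in> \<P> y \<Longrightarrow> card (P' \<inter> Q') \<le> card (P \<inter> Q)"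
    by fastforce
  have ins: "pairwise (\<lambda>x y. (x, y) \<in> E) (insert u K) \<longleftrightarrow>
      pairwise (\<lambda>x y. (x, y) \<in> E) K \<and> (\<forall>v\<in>K. v \<noteq> u \<longrightarrow> (v, u) \<in> E)" for u K
    using E_sym by (auto simp: pairwise_insert)
  have PV: "P \<subseteq> V" "Q \<subseteq> V" "finite P" "finite Q" "Suc (card P) = r" "Suc (card Q) = r"
    "pairwise (\<lambda>x y. (x, y) \<in> E) P" "pairwise (\<lambda>x y. (x, y) \<in> E) Q"
    "\<And>p. p \<in> P \<Longrightarrow> (p, x) \<in> E \<and> (p, z) \<in> E" "\<And>p. p \<in> Q \<Longrightarrow> (p, y) \<in> E \<and> (p, z) \<in> E"
    using P Q fin finite_subset by (auto simp: \<P>_def)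
  have notin: "x \<notin> P" "z \<notin> P" "y \<notin> Q" "z \<notin> Q" using PV E_irr by blast+
  \<comment> \<open>Distinctness leaves at most \<open>r - 2\<close> common vertices, so the three
    sets have sizes \<open>r\<close>, \<open>r\<close> and at most \<open>r - 1\<close>. This is the
    origin of \<open>3 * r - 1\<close>.\<close>
  have "P \<noteq> Q"
  proof
    assume "P = Q"
    then have "card (insert x (insert y P)) \<le> r"
      using PV V xy E_sym by (intro free) (auto simp: ins)
    then show False using PV notin neq \<open>P = Q\<close> by simp
  qed
  then have "card (P \<inter> Q) < card P"
    using PV by (metis Int_lower1 Int_lower2 card_subset_eq nat.inject le_neq_implies_less card_mono)
  then have k: "card (insert x P) + card (insert y Q) + card (insert z (P \<inter> Q)) \<le> 3 * r - 1"
    using PV notin by simp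
  define m where "m K v = card {u \<in> K. (u, v) \<notin> E}" for K v
  \<comment> \<open>A vertex adjacent to all of an \<open>r\<close>-clique would extend it. If
    \<open>v\<close> lies in \<open>K\<close>, it counts as its own nonneighbour.\<close>
  have m_pos: "m K v \<ge> 1" if "K \<subseteq> V" "v \<in> V" "card K = r" "pairwise (\<lambda>x y. (x, y) \<in> E) K" for K v
  proof (rule ccontr)
    assume "\<not> ?thesis"
    moreover have finK: "finite K" using that fin finite_subset by blast
    ultimately have "{u \<in> K. (u, v) \<notin> E} = {}" by (simp add: m_def not_le)
    then have adj: "\<forall>u\<in>K. (u, v) \<in> E" by blast
    then have "v \<notin> K" using E_irr by blast
    moreover have "card (insert v K) \<le> r" using that adj by (intro free) (auto simp: ins)
    ultimately show False using that finK by simp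
  qed
  have improve: "insert v (P - {p}) \<in> \<P> u"
    if "P \<in> \<P> u" "p \<in> P" "v \<in> V" "\<And>p'. p' \<in> insert z (insert u (P - {p})) \<Longrightarrow> (p', v) \<in> E" for u v p P
  proof -
    have "v \<notin> P - {p}" using that(4) E_irr by blast
    moreover have "finite P" using that fin finite_subset by (auto simp: \<P>_def)
    ultimately have "Suc (card (insert v (P - {p}))) = r"
      using that card_Suc_Diff1[of P p] by (simp add: \<P>_def)
    moreover have "pairwise (\<lambda>x y. (x, y) \<in> E) (P - {p})"
      using that(1) by (auto simp: \<P>_def intro: pairwise_subset)
    ultimately show ?thesis using that E_sym by (auto simp: \<P>_def ins)
  qed
  have single: "\<exists>p. p \<in> K \<and> (p, v) \<notin> E \<and> (\<forall>u\<in>K - {p}. (u, v) \<in> E)" if "m K v = 1" for K v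
  proof -
    obtain p where "{u \<in> K. (u, v) \<notin> E} = {p}"
      using \<open>m K v = 1\<close> unfolding m_def by (rule card_1_singletonE)
    then show ?thesis by blast
  qed
  \<comment> \<open>The only nonneighbour of \<open>v\<close> in \<open>insert u P\<close> cannot be
    \<open>u\<close>: otherwise \<open>v\<close>, being adjacent to \<open>z\<close> too, would be
    adjacent to the whole \<open>r\<close>-clique \<open>insert z P\<close>.\<close>
  have missing: "\<exists>p\<in>P. (p, v) \<notin> E \<and> (u, v) \<in> E \<and> (\<forall>p'\<in>P - {p}. (p', v) \<in> E)"
    if P: "P \<in> \<P> u" and "v \<in> V" "(z, v) \<in> E" and m1: "m (insert u P) v = 1" for P u v
  proof -
    obtain p where p: "p \<in> insert u P" "(p, v) \<notin> E" "\<forall>p'\<in>insert u P - {p}. (p', v) \<in> E"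
      using single[OF m1] by blast
    have uP: "u \<notin> P" using P E_irr by (auto simp: \<P>_def)
    have "p \<noteq> u"
    proof
      assume "p = u"
      then have adj: "\<forall>p'\<in>P. (p', v) \<in> E" using p uP by auto
      moreover have "m (insert z P) v \<ge> 1"
        using P V \<open>v \<in> V\<close> fin finite_subset[of P V] E_irr
        by (intro m_pos) (auto simp: \<P>_def ins card_insert_if)
      ultimately show False using \<open>(z, v) \<in> E\<close> unfolding m_def
        by (metis (mono_tags, lifting) Collect_empty_eq card.empty insert_iff not_one_le_zero)
    qed
    then show ?thesis using p by auto
  qed
  text \<open>
    With only two nonneighbours, \<open>v\<close> would miss one vertex each of \<open>P\<close> and \<open>Q\<close>;
    exchanging both for \<open>v\<close> would enlarge \<open>P \<inter> Q\<close>.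
  \<close>
  have three: "3 \<le> m (insert x P) v + m (insert y Q) v + m (insert z (P \<inter> Q)) v" if v: "v \<in> V" for v
  proof (rule ccontr)
    assume neg: "\<not> ?thesis"
    have "m (insert x P) v \<ge> 1" "m (insert y Q) v \<ge> 1"
      using m_pos[of "insert x P" v] m_pos[of "insert y Q" v] PV V v notin by (auto simp: ins)
    with neg have eq: "m (insert x P) v = 1" "m (insert y Q) v = 1" "m (insert z (P \<inter> Q)) v = 0" by auto
    have adj: "(z, v) \<in> E" "\<forall>u\<in>P \<inter> Q. (u, v) \<in> E"
      using eq(3) PV by (auto simp: m_def)
    obtain p where p: "p \<in> P" "(p, v) \<notin> E" "(x, v) \<in> E" "\<forall>p'\<in>P - {p}. (p', v) \<in> E"
      using missing[OF P v adj(1) eq(1)] by blast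
    obtain q where q: "q \<in> Q" "(q, v) \<notin> E" "(y, v) \<in> E" "\<forall>p'\<in>Q - {q}. (p', v) \<in> E"
      using missing[OF Q v adj(1) eq(2)] by blast
    have "card (insert v (P - {p}) \<inter> insert v (Q - {q})) \<le> card (P \<inter> Q)"
      using p q adj v P Q by (intro max improve) auto
    moreover have "insert v (P - {p}) \<inter> insert v (Q - {q}) = insert v (P \<inter> Q)"
      using p q adj by auto
    moreover have "v \<notin> P \<inter> Q" using adj E_irr by blast
    ultimately show False using PV by simp
  qed
  have bound: "(3 * r - 1) * (\<Sum>v\<in>V. m K v) < 3 * card V * card K" if "K \<subseteq> V" "K \<noteq> {}" for K
  proof -
    have "finite K" using that fin finite_subset by blast
    then have "(3 * r - 1) * (\<Sum>v\<in>V. m K v) = (\<Sum>u\<in>K. (3 * r - 1) * card {v \<in> V. (u, v) \<notin> E})"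
      using fin by (simp add: m_def sum_card_nonneighbours sum_distrib_left)
    also have "\<dots> < (\<Sum>u\<in>K. 3 * card V)"
      using that deg \<open>finite K\<close> by (intro sum_strict_mono) auto
    finally show ?thesis by (simp add: mult.commute)
  qed
  have "(3 * r - 1) * (3 * card V) \<le>
      (3 * r - 1) * (\<Sum>v\<in>V. m (insert x P) v + m (insert y Q) v + m (insert z (P \<inter> Q)) v)"
    using sum_mono[OF three, of V "\<lambda>v. v"] by (intro mult_le_mono2) (simp add: mult.commute)
  also have "\<dots> < 3 * card V * (card (insert x P) + card (insert y Q) + card (insert z (P \<inter> Q)))"
  proof -
    have "insert x P \<subseteq> V" "insert y Q \<subseteq> V" "insert z (P \<inter> Q) \<subseteq> V" using V PV by auto
    from this[THEN bound] show ?thesis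
      by (simp add: sum.distrib distrib_left del: card_insert_disjoint)
  qed
  also have "\<dots> \<le> 3 * card V * (3 * r - 1)" using k by (rule mult_le_mono2)
  finally show False by (simp add: mult.commute)
qed

text \<open>Adding edges without creating a clique larger than \<open>r\<close> preserves the degree
  condition, and a proper colouring of the larger graph is proper for the original one. Hence an
  edge-maximal \<open>F\<close> may replace \<open>E\<close>.\<close>

theorem Andrasfai_Erdos_Sos:
  assumes fin: "finite V" and EV: "E \<subseteq> V \<times> V" and sym: "sym E" and irr: "irrefl E" and r: "r \<ge> 1"
    and free: "\<And>K. K \<subseteq> V \<Longrightarrow> pairwise (\<lambda>x y. (x, y) \<in> E) K \<Longrightarrow> card K \<le> r"
    and deg: "\<And>u. u \<in> V \<Longrightarrow>
      real (card {v \<in> V. (u, v) \<in> E}) > (3 * real r - 4) / (3 * real r - 1) * real (card V)"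
  shows "\<exists>c::'a \<Rightarrow> nat. c ` V \<subseteq> {..<r} \<and> (\<forall>x\<in>V. \<forall>y\<in>V. (x, y) \<in> E \<longrightarrow> c x \<noteq> c y)"
proof -
  define \<E> where "\<E> = {F. E \<subseteq> F \<and> F \<subseteq> V \<times> V \<and> Relation.sym F \<and> irrefl F
    \<and> (\<forall>K\<subseteq>V. pairwise (\<lambda>x y. (x, y) \<in> F) K \<longrightarrow> card K \<le> r)}"
  have "finite \<E>" by (rule finite_subset[of _ "Pow (V \<times> V)"]) (auto simp: \<E>_def fin)
  moreover have "E \<in> \<E>" using assms by (auto simp: \<E>_def)
  ultimately obtain F where F: "F \<in> \<E>" and max: "\<And>F'. F' \<in> \<E> \<Longrightarrow> F \<subseteq> F' \<Longrightarrow> F' = F"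
    using finite_has_maximal[of \<E>] by blast
  have FE: "E \<subseteq> F" "F \<subseteq> V \<times> V" "Relation.sym F" "irrefl F"
    and F_free: "\<And>K. K \<subseteq> V \<Longrightarrow> pairwise (\<lambda>x y. (x, y) \<in> F) K \<Longrightarrow> card K \<le> r"
    using F by (auto simp: \<E>_def)
  have F_sym: "(u, v) \<in> F \<longleftrightarrow> (v, u) \<in> F" for u v using FE(3) by (meson symE)
  \<comment> \<open>The complementary form of the degree condition, over the natural numbers;
    \<open>r \<ge> 1\<close> keeps \<open>3 * r - 1\<close> from truncating.\<close>
  have F_deg: "(3 * r - 1) * card {v \<in> V. (u, v) \<notin> F} < 3 * card V" if "u \<in> V" for u
  proof -
    have "card {v \<in> V. (u, v) \<in> E} \<le> card {v \<in> V. (u, v) \<in> F}"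
      using FE fin by (intro card_mono) auto
    moreover have "card V = card {v \<in> V. (u, v) \<in> F} + card {v \<in> V. (u, v) \<notin> F}"
      using fin by (subst card_Un_disjoint[symmetric]) (auto intro!: arg_cong[of _ _ card])
    ultimately have le: "real (card {v \<in> V. (u, v) \<in> E}) \<le> real (card V) - real (card {v \<in> V. (u, v) \<notin> F})"
      by linarith
    have pos: "3 * real r - 1 > 0" using r by simp
    have "(3 * real r - 4) * real (card V) < (3 * real r - 1) * real (card {v \<in> V. (u, v) \<in> E})"
      using deg[OF that] pos by (simp add: field_simps)
    also have "\<dots> \<le> (3 * real r - 1) * (real (card V) - real (card {v \<in> V. (u, v) \<notin> F}))"
      using le pos by (intro mult_left_mono) auto
    finally have "(3 * real r - 1) * real (card {v \<in> V. (u, v) \<notin> F}) < 3 * real (card V)"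
      by (simp add: algebra_simps)
    moreover have "real (3 * r - 1) = 3 * real r - 1" using r by (simp add: of_nat_diff)
    ultimately have "real ((3 * r - 1) * card {v \<in> V. (u, v) \<notin> F}) < real (3 * card V)"
      by (simp only: of_nat_mult of_nat_numeral)
    then show ?thesis by linarith
  qed
  \<comment> \<open>The new edge \<open>xy\<close> creates a clique with more than \<open>r\<close>
    vertices. It must use both ends of that edge, and without \<open>x\<close> it has at most
    \<open>r\<close> vertices; hence exactly \<open>r - 1\<close> remain once both ends are
    removed.\<close>
  have sat: "\<exists>P\<subseteq>V. Suc (card P) = r \<and> pairwise (\<lambda>x y. (x, y) \<in> F) P \<and> (\<forall>p\<in>P. (p, x) \<in> F \<and> (p, y) \<in> F)"
    if xy: "x \<in> V" "y \<in> V" "x \<noteq> y" "(x, y) \<notin> F" for x y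
  proof -
    define F' where "F' = insert (x, y) (insert (y, x) F)"
    have "F' \<notin> \<E>" using max[of F'] xy by (auto simp: F'_def)
    moreover have "E \<subseteq> F'" "F' \<subseteq> V \<times> V" "Relation.sym F'" "irrefl F'"
      using FE xy by (auto simp: F'_def sym_def irrefl_def)
    ultimately obtain K where K: "K \<subseteq> V" "pairwise (\<lambda>x y. (x, y) \<in> F') K" "\<not> card K \<le> r"
      by (auto simp: \<E>_def)
    have finK: "finite K" using K fin finite_subset by blast
    have small: "card L \<le> r" if "L \<subseteq> K" "x \<notin> L \<or> y \<notin> L" for L
      using K that by (intro F_free) (auto simp: pairwise_def F'_def)
    have xyK: "x \<in> K" "y \<in> K" using small[of K] K by auto
    have "Suc (Suc (card (K - {x} - {y}))) = card K"
      using xyK xy finK card_Suc_Diff1[of K x] card_Suc_Diff1[of "K - {x}" y] by simp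
    moreover have "card (K - {x}) \<le> r" by (rule small) auto
    ultimately have "Suc (card (K - {x} - {y})) = r" using K xyK finK by simp
    then show ?thesis using K xyK xy F_sym
      by (intro exI[of _ "K - {x} - {y}"]) (auto simp: pairwise_def F'_def)
  qed
  have "\<exists>c::'a \<Rightarrow> nat. c ` V \<subseteq> {..<r} \<and> (\<forall>x\<in>V. \<forall>y\<in>V. (x, y) \<in> F \<longrightarrow> c x \<noteq> c y)"
  proof (rule coloring_of_transitive_nonadjacency[OF fin FE(3,4) F_free])
    fix x y z assume "x \<in> V" "y \<in> V" "z \<in> V" "(x, z) \<notin> F" "(z, y) \<notin> F"
    then show "(x, y) \<notin> F"
      using nonadjacency_transitive_of_saturated[OF fin FE(3,4) F_free sat F_deg] by blast
  qed
  then obtain c :: "'a \<Rightarrow> nat" where "c ` V \<subseteq> {..<r}" "\<And>x y. x \<in> V \<Longrightarrow> y \<in> V \<Longrightarrow> (x, y) \<in> F \<Longrightarrow> c x \<noteq> c y"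
    by metis
  then show ?thesis using FE(1) by (intro exI[of _ c]) (simp add: subset_iff)
qed

section \<open>Independent sets for the blue edges\<close>

text \<open>Here \<open>R\<close> is a matching on \<open>X\<close>: take all isolated vertices and
  one end of each edge. The induction splits off one edge at a time.\<close>

lemma large_independent_set:
  assumes "finite X" and sym: "\<And>x y. R x y \<Longrightarrow> R y x" and irr: "\<And>x. \<not> R x x"
    and "\<And>x. x \<in> X \<Longrightarrow> card {y \<in> X. R x y} \<le> 1"
  shows "\<exists>I\<subseteq>X. pairwise (\<lambda>x y. \<not> R x y) I \<and>
    card X + card {x \<in> X. \<forall>y\<in>X. \<not> R x y} \<le> 2 * card I"
  using assms(1,4)
proof (induction "card X" arbitrary: X rule: less_induct)
  case less
  define J where "J = {x \<in> X. \<forall>y\<in>X. \<not> R x y}"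
  show ?case
  proof (cases "J = X")
    case True
    then show ?thesis by (intro exI[of _ X]) (auto simp: J_def pairwise_def)
  next
    case False
    then obtain x y where xy: "x \<in> X" "y \<in> X" "R x y" by (auto simp: J_def)
    have neq: "x \<noteq> y" using irr xy by auto
    have only: "z = v" if "u \<in> X" "v \<in> X" "z \<in> X" "R u v" "R u z" for u v z
    proof -
      have "card {v, z} \<le> card {y \<in> X. R u y}"
        using that less.prems by (intro card_mono) auto
      then show ?thesis using less.prems(2)[OF that(1)] by (cases "z = v") auto
    qed
    define Y where "Y = X - {x} - {y}"
    have cY: "card X = Suc (Suc (card Y))"
      using xy neq less.prems(1) card_Suc_Diff1[of X x] card_Suc_Diff1[of "X - {x}" y]
      by (simp add: Y_def)
    have "card {v \<in> Y. R u v} \<le> 1" if "u \<in> Y" for u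
    proof -
      have "card {v \<in> Y. R u v} \<le> card {v \<in> X. R u v}"
        using less.prems(1) by (intro card_mono) (auto simp: Y_def)
      then show ?thesis using less.prems(2)[of u] that by (simp add: Y_def)
    qed
    then obtain I where I: "I \<subseteq> Y" "pairwise (\<lambda>x y. \<not> R x y) I"
      "card Y + card {x \<in> Y. \<forall>y\<in>Y. \<not> R x y} \<le> 2 * card I"
      using less.hyps[of Y] cY less.prems(1) by (auto simp: Y_def)
    have "card J \<le> card {x \<in> Y. \<forall>y\<in>Y. \<not> R x y}"
      using less.prems(1) xy sym by (intro card_mono) (auto simp: Y_def J_def)
    moreover have "finite I" "x \<notin> I" using I less.prems(1) finite_subset[of I X] by (auto simp: Y_def)
    moreover have "\<not> R x u" "\<not> R u x" if "u \<in> I" for u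
    proof -
      have "u \<in> X" "u \<noteq> y" using that I by (auto simp: Y_def)
      then show "\<not> R x u" using only[of x y u] xy by blast
      then show "\<not> R u x" using sym by blast
    qed
    then have "pairwise (\<lambda>x y. \<not> R x y) (insert x I)"
      using I by (simp add: pairwise_insert)
    ultimately show ?thesis using I cY xy
      by (intro exI[of _ "insert x I"]) (auto simp: J_def Y_def)
  qed
qed

text \<open>On the vertices of degree at most one, \<open>large_independent_set\<close> gives the
  bound without the summand 2; a vertex of degree at least two pays for it. Let \<open>L\<close>
  consist of the vertices of degree one whose neighbour lies in \<open>S\<close>; they are isolated
  in \<open>U \<union> T\<close>. Two of them yield the surplus. If there is at most one, some
  \<open>q\<close> in \<open>S\<close> has no neighbour in \<open>L\<close>, hence none in
  \<open>U \<union> T\<close>, and joins as one more isolated vertex, which counts twice.\<close>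

lemma independent_set_degree_ge_two:
  assumes fin: "finite A" and sym: "\<And>x y. R x y \<Longrightarrow> R y x" and irr: "\<And>x. \<not> R x x"
  defines "bd \<equiv> \<lambda>x. card {y \<in> A. R x y}"
  assumes s: "s \<in> A" "bd s \<ge> 2"
  shows "\<exists>I\<subseteq>A. pairwise (\<lambda>x y. \<not> R x y) I \<and>
    2 * card {x \<in> A. bd x = 0} + card {x \<in> A. bd x = 1} + 2 \<le> 2 * card I"
proof -
  define U T S where "U = {x \<in> A. bd x = 0}" and "T = {x \<in> A. bd x = 1}" and "S = {x \<in> A. bd x \<ge> 2}"
  define L where "L = {x \<in> T. \<exists>y\<in>S. R x y}"
  have finUTL: "finite U" "finite T" "finite L" using fin by (auto simp: U_def T_def L_def)
  have disj: "U \<inter> T = {}" "U \<inter> S = {}" "T \<inter> S = {}" "U \<union> T \<subseteq> A" "L \<subseteq> T" "S \<subseteq> A"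
    by (auto simp: U_def T_def S_def L_def)
  have A_eq: "A = U \<union> T \<union> S" by (auto simp: U_def T_def S_def)
  have U_iso: "\<not> R x y" "\<not> R y x" if "x \<in> U" "y \<in> A" for x y
    using that sym fin by (auto simp: U_def bd_def)
  have only: "z = v" if "u \<in> T" "v \<in> A" "z \<in> A" "R u v" "R u z" for u v z
  proof -
    have "card {v, z} \<le> card {y \<in> A. R u y}"
      using that fin by (intro card_mono) auto
    then show ?thesis using that by (cases "z = v") (auto simp: T_def bd_def)
  qed
  have L_iso: "\<not> R x y" if "x \<in> L" "y \<in> U \<union> T" for x y
    using that only[of x _ y] disj A_eq by (auto simp: L_def)
  have ex: "\<exists>I\<subseteq>A. pairwise (\<lambda>x y. \<not> R x y) I \<and> card X + card J \<le> 2 * card I"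
    if "X \<subseteq> A" "J \<subseteq> X" and deg: "\<And>x. x \<in> X \<Longrightarrow> card {y \<in> X. R x y} \<le> 1" and "\<And>x y. x \<in> J \<Longrightarrow> y \<in> X \<Longrightarrow> \<not> R x y" for X J
  proof -
    have finX: "finite X" using that fin finite_subset by blast
    obtain I where "I \<subseteq> X" "pairwise (\<lambda>x y. \<not> R x y) I"
      "card X + card {x \<in> X. \<forall>y\<in>X. \<not> R x y} \<le> 2 * card I"
      using large_independent_set[OF finX sym irr deg] by blast
    moreover have "card J \<le> card {x \<in> X. \<forall>y\<in>X. \<not> R x y}"
      using that finX by (intro card_mono) auto
    ultimately show ?thesis using that(1) by (intro exI[of _ I]) auto
  qed
  have deg_le: "card {y \<in> X. R x y} \<le> 1" if "x \<in> U \<union> T" "X \<subseteq> A" for x X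
  proof -
    have "card {y \<in> X. R x y} \<le> bd x" unfolding bd_def
      using that fin by (intro card_mono) auto
    then show ?thesis using that by (auto simp: U_def T_def)
  qed
  show ?thesis unfolding U_def[symmetric] T_def[symmetric]
  proof (cases "card L \<ge> 2")
    case True
    have "\<exists>I\<subseteq>A. pairwise (\<lambda>x y. \<not> R x y) I \<and> card (U \<union> T) + card (U \<union> L) \<le> 2 * card I"
    proof (rule ex)
      show "\<not> R x y" if "x \<in> U \<union> L" "y \<in> U \<union> T" for x y
        using that U_iso[of x y] L_iso[of x y] disj(4) by auto
      show "card {y \<in> U \<union> T. R x y} \<le> 1" if "x \<in> U \<union> T" for x
        using deg_le[OF that disj(4)] .
    qed (use disj in auto)
    then obtain I where "I \<subseteq> A" "pairwise (\<lambda>x y. \<not> R x y) I" "card (U \<union> T) + card (U \<union> L) \<le> 2 * card I"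
      by blast
    moreover have "card (U \<union> T) = card U + card T" "card (U \<union> L) = card U + card L"
      using disj finUTL by (auto intro!: card_Un_disjoint)
    ultimately show "\<exists>I\<subseteq>A. pairwise (\<lambda>x y. \<not> R x y) I \<and> 2 * card U + card T + 2 \<le> 2 * card I"
      using True by (intro exI[of _ I]) auto
  next
    case False
    \<comment> \<open>If \<open>s\<close> fails, then \<open>L\<close> is a singleton
      \<open>{l}\<close> and \<open>s\<close> is the only neighbour of \<open>l\<close>. Another
      neighbour \<open>q\<close> of \<open>s\<close> works: having the neighbour \<open>s\<close>,
      it is not in \<open>U\<close>, and in \<open>T\<close> it would belong to
      \<open>L\<close>.\<close>
    have "\<exists>q\<in>S. \<forall>l\<in>L. \<not> R l q"
    proof (cases "\<exists>l\<in>L. R l s")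
      case False
      then show ?thesis using s by (auto simp: S_def)
    next
      case True
      then obtain l where l: "l \<in> L" "R l s" by blast
      have L1: "l' = l" if "l' \<in> L" for l'
      proof -
        have "card {l, l'} \<le> card L" using that l finUTL by (intro card_mono) auto
        then show ?thesis using False by (cases "l' = l") auto
      qed
      have "\<not> {y \<in> A. R s y} \<subseteq> {l}"
        using s(2) card_mono[of "{l}" "{y \<in> A. R s y}"] by (auto simp: bd_def)
      then obtain q where q: "q \<in> A" "R s q" "q \<noteq> l" by blast
      have "q \<notin> L" using L1 q by blast
      moreover have "R q s" using q sym by blast
      moreover have "s \<in> S" using s by (simp add: S_def)
      moreover have "q \<in> U \<union> T \<union> S" using q A_eq by simp
      ultimately have "q \<in> S" using s U_iso[of q s] by (auto simp: L_def)
      moreover have "\<not> R l q"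
      proof
        assume "R l q"
        moreover have "l \<in> T" using l disj by blast
        ultimately have "q = s" using only[of l s q] l q s by simp
        then show False using q irr by simp
      qed
      ultimately show ?thesis using L1 by blast
    qed
    then obtain q where q: "q \<in> S" "\<And>l. l \<in> L \<Longrightarrow> \<not> R l q" by blast
    have q_iso: "\<not> R x q" "\<not> R q x" if "x \<in> U \<union> T" for x
    proof -
      show "\<not> R x q" using that q U_iso[of x q] disj by (auto simp: L_def)
      then show "\<not> R q x" using sym by blast
    qed
    define X where "X = insert q (U \<union> T)"
    have XA: "X \<subseteq> A" using disj q by (auto simp: X_def)
    have X_deg: "card {y \<in> X. R x y} \<le> 1" if "x \<in> X" for x
    proof (cases "x = q")
      case True
      then have "{y \<in> X. R x y} = {}" using q_iso irr by (auto simp: X_def)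
      then show ?thesis by (simp only: card.empty)
    next
      case False
      then have "x \<in> U \<union> T" using that by (simp add: X_def)
      then show ?thesis using deg_le XA by blast
    qed
    have "\<exists>I\<subseteq>A. pairwise (\<lambda>x y. \<not> R x y) I \<and> card X + card (insert q U) \<le> 2 * card I"
    proof (rule ex[OF XA _ X_deg])
      show "\<not> R x y" if "x \<in> insert q U" "y \<in> X" for x y
        using that q_iso[of y] U_iso[of x y] XA irr by (auto simp: X_def)
    qed (auto simp: X_def)
    then obtain I where "I \<subseteq> A" "pairwise (\<lambda>x y. \<not> R x y) I" "card X + card (insert q U) \<le> 2 * card I"
      by blast
    moreover have "card X = Suc (card U + card T)" "card (insert q U) = Suc (card U)"
      using disj finUTL q by (auto simp: X_def card_insert_if card_Un_disjoint)
    ultimately show "\<exists>I\<subseteq>A. pairwise (\<lambda>x y. \<not> R x y) I \<and> 2 * card U + card T + 2 \<le> 2 * card I"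
      by (intro exI[of _ I]) auto
  qed
qed

section \<open>Bounding the nongreen cliques\<close>

text \<open>Otherwise some vertices of \<open>B\<close>, extended inside \<open>A\<close> to the
  right order, span a supergraph of a member of the forbidden family.\<close>

lemma F_family_free_clique_bound:
  assumes G: "coloured_graph (V, w)" and free: "family_free (V, w) (F_family (2 * r + 1))" and r: "r \<ge> 1"
    and A: "A \<subseteq> V" "pairwise (\<lambda>x y. w x y \<noteq> 0) A"
    and B: "B \<subseteq> A" "B \<noteq> {}" "pairwise (\<lambda>x y. w x y = 2) B"
  shows "card A + card B \<le> 2 * r"
proof (rule ccontr)
  assume big: "\<not> ?thesis"
  have fin: "finite V" "finite A" "finite B"
    using G A(1) B(1) finite_subset[of A V] finite_subset[of B A] by (auto simp: coloured_graph_def)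
  have BA: "card B \<le> card A" using B fin by (intro card_mono)
  \<comment> \<open>The family only admits indices up to \<open>r\<close>. If \<open>B\<close> is
    larger than that, \<open>A\<close> has at least \<open>r + 1 = 2 * r + 1 - r\<close> vertices,
    so the index \<open>r\<close> is available.\<close>
  define b where "b = min (card B) r"
  have b: "1 \<le> b" "b \<le> r" "b \<le> card B" using r B fin by (auto simp: b_def card_gt_0_iff Suc_le_eq)
  have size: "2 * r + 1 - b \<le> card A" "b \<le> 2 * r + 1 - b" using big BA b by (auto simp: b_def min_def)
  obtain B' where B': "B' \<subseteq> B" "card B' = b" "finite B'"
    using obtain_subset_with_card_n[OF b(3)] by metis
  obtain A' where A': "B' \<subseteq> A'" "A' \<subseteq> A" "card A' = 2 * r + 1 - b"
    using exists_subset_between[of B' "2 * r + 1 - b" A] B B' size fin by auto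
  have finA': "finite A'" using A' fin finite_subset by blast
  define a where "a = 2 * r + 1 - b"
  obtain f where f: "bij_betw f B' {..<b}"
    using finite_same_card_bij[of B' "{..<b}"] B' by auto
  have "card (A' - B') = card {b..<a}" using A' B' by (simp add: card_Diff_subset a_def)
  then obtain g where g: "bij_betw g (A' - B') {b..<a}"
    using finite_same_card_bij[of "A' - B'" "{b..<a}"] finA' by auto
  define \<phi> where "\<phi> x = (if x \<in> B' then f x else g x)" for x
  have "bij_betw \<phi> (B' \<union> (A' - B')) ({..<b} \<union> {b..<a})"
  proof (rule bij_betw_combine)
    show "bij_betw \<phi> B' {..<b}" using f by (subst bij_betw_cong[of _ _ f]) (auto simp: \<phi>_def)
    show "bij_betw \<phi> (A' - B') {b..<a}" using g by (subst bij_betw_cong[of _ _ g]) (auto simp: \<phi>_def)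
  qed auto
  moreover have "B' \<union> (A' - B') = A'" "{..<b} \<union> {b..<a} = {..<a}"
    using A' size by (auto simp: a_def)
  ultimately have \<phi>: "bij_betw \<phi> A' {..<a}" by simp
  have \<phi>_less: "\<phi> x < b \<longleftrightarrow> x \<in> B'" if "x \<in> A'" for x
    using that bij_betwE[OF f] bij_betwE[OF g] by (force simp: \<phi>_def not_less)
  have inj: "\<phi> x = \<phi> y \<longleftrightarrow> x = y" if "x \<in> A'" "y \<in> A'" for x y
    using \<phi> that by (auto simp: bij_betw_def inj_on_eq_iff)
  define F where "F = G_graph (2 * r + 1) b"
  \<comment> \<open>Pulling the weights back along \<open>\<phi>\<close> makes the isomorphism
    automatic. Extra red edges of \<open>w\<close> on \<open>A'\<close> do no harm, since a subgraph
    may lower weights.\<close>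
  define H where "H = (A', \<lambda>x y. weight F (\<phi> x) (\<phi> y))"
  have iso: "isomorphic H F"
    using \<phi> unfolding isomorphic_def by (intro exI[of _ \<phi>]) (auto simp: H_def F_def G_graph_def a_def)
  have wt: "w x y \<ge> (if x = y then 0 else if x \<in> B' \<and> y \<in> B' then 2 else 1)" if "x \<in> A'" "y \<in> A'" for x y
  proof -
    have "x \<noteq> y \<longrightarrow> w x y \<noteq> 0" using that A(2) subsetD[OF A'(2)] by (simp add: pairwise_def)
    moreover have "x \<noteq> y \<longrightarrow> x \<in> B' \<longrightarrow> y \<in> B' \<longrightarrow> w x y = 2"
      using B B' by (auto simp: pairwise_def)
    ultimately show ?thesis by auto
  qed
  have "subgraph H (V, w)"
    unfolding subgraph_def
  proof (intro conjI G)
    show "coloured_graph H"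
      using finA' by (auto simp: coloured_graph_def H_def F_def G_graph_def)
    show "verts H \<subseteq> verts (V, w)" using A A' by (auto simp: H_def)
    show "\<forall>x\<in>verts H. \<forall>y\<in>verts H. weight H x y \<le> weight (V, w) x y"
    proof (intro ballI)
      fix x y assume "x \<in> verts H" "y \<in> verts H"
      then have xy: "x \<in> A'" "y \<in> A'" by (simp_all add: H_def)
      show "weight H x y \<le> weight (V, w) x y"
        using wt[OF xy] \<phi>_less[OF xy(1)] \<phi>_less[OF xy(2)] inj[OF xy]
        by (auto simp: H_def F_def G_graph_def split: if_splits)
    qed
  qed
  moreover have "F \<in> F_family (2 * r + 1)" using b by (auto simp: F_family_def F_def)
  ultimately show False using free iso unfolding family_free_def free_of_def by blast
qed

text \<open>The deficiency of a pair is 2 minus its weight. Each vertex of \<open>V\<close> has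
  weighted deficiency at least 4 into \<open>A\<close>. On the other side, the deficiencies at a
  single vertex of \<open>A\<close> sum to less than \<open>6 / (3 * r - 1) * card V\<close>, and
  the weights \<open>c\<close> sum to at most \<open>2 * r - 2 / 3\<close>; the product of these
  bounds is exactly \<open>4 * card V\<close>.\<close>

lemma nongreen_clique_bound:
  assumes G: "coloured_graph (V, w)" and free: "family_free (V, w) (F_family (2 * r + 1))" and r: "r \<ge> 1"
    and deg: "\<And>x. x \<in> V \<Longrightarrow> (6 * real r - 8) / (3 * real r - 1) * real (card V) < real (degree (V, w) x)"
    and K: "K \<subseteq> V" "pairwise (\<lambda>x y. w x y \<noteq> 0) K"
  shows "card K \<le> r"
proof (rule ccontr)
  assume "\<not> ?thesis"
  have finV: "finite V" and w012: "\<And>x y. x \<in> V \<Longrightarrow> y \<in> V \<Longrightarrow> w x y \<in> {0, 1, 2}"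
    and w_sym: "\<And>x y. x \<in> V \<Longrightarrow> y \<in> V \<Longrightarrow> w x y = w y x" and w_irr: "\<And>x. x \<in> V \<Longrightarrow> w x x = 0"
    using G by (auto simp: coloured_graph_def)
  define \<beta> :: "'a \<Rightarrow> 'a \<Rightarrow> nat" where "\<beta> x y = of_bool (w x y = 1)" for x y
  define clq where "clq A \<longleftrightarrow> A \<subseteq> V \<and> pairwise (\<lambda>x y. w x y \<noteq> 0) A" for A
  have "\<exists>A. clq A \<and> (\<forall>A'. clq A' \<longrightarrow> card A' \<le> card A)"
    using K card_mono[OF finV] by (intro ex_has_greatest_nat[of clq K card "Suc (card V)"]) (auto simp: clq_def less_Suc_eq_le)
  then obtain A0 where A0: "clq A0" "\<And>A'. clq A' \<Longrightarrow> card A' \<le> card A0" by blast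
  obtain A where A: "clq A" "card A = card A0"
    and min: "\<And>A'. clq A' \<Longrightarrow> card A' = card A0 \<Longrightarrow>
      (\<Sum>x\<in>A. \<Sum>y\<in>A. \<beta> x y) \<le> (\<Sum>x\<in>A'. \<Sum>y\<in>A'. \<beta> x y)"
    using ex_has_least_nat[of "\<lambda>A. clq A \<and> card A = card A0" A0 "\<lambda>A. \<Sum>x\<in>A. \<Sum>y\<in>A. \<beta> x y"] A0 by blast
  have max: "card A' \<le> card A" if "clq A'" for A' using A A0 that by simp
  have AV: "A \<subseteq> V" and A_clq: "\<And>x y. x \<in> A \<Longrightarrow> y \<in> A \<Longrightarrow> x \<noteq> y \<Longrightarrow> w x y \<noteq> 0"
    using A by (auto simp: clq_def pairwise_def)
  have finA: "finite A" using AV finV finite_subset by blast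
  have large: "card A \<ge> r + 1" using max[of K] K \<open>\<not> card K \<le> r\<close> by (auto simp: clq_def)
  \<comment> \<open>The restriction to \<open>V\<close> makes the relation symmetric and irreflexive
    on the whole type, as the lemmas on independent sets require.\<close>
  define blue where "blue x y \<longleftrightarrow> x \<in> V \<and> y \<in> V \<and> w x y = 1" for x y
  have blue_sym: "blue x y \<Longrightarrow> blue y x" and blue_irr: "\<not> blue x x" for x y
    using w_sym w_irr by (auto simp: blue_def)
  define bd where "bd x = card {y \<in> A. blue x y}" for x
  have sum_\<beta>: "(\<Sum>y\<in>X. \<beta> z y) = card {y \<in> X. blue z y}" if "z \<in> V" "X \<subseteq> V" for X z
  proof -
    have "finite X" using that finV finite_subset by blast
    moreover have "{y \<in> X. blue z y} = {y \<in> X. w z y = 1}" using that by (auto simp: blue_def)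
    ultimately show ?thesis by (simp add: \<beta>_def of_bool_def sum.If_cases Int_def)
  qed
  have sum_\<beta>_insert: "(\<Sum>x\<in>insert u X. \<Sum>y\<in>insert u X. \<beta> x y) = (\<Sum>x\<in>X. \<Sum>y\<in>X. \<beta> x y) + 2 * card {y \<in> X. blue u y}"
    if "u \<in> V" "X \<subseteq> V" "u \<notin> X" for u X
  proof -
    have "finite X" using that finV finite_subset by blast
    moreover have "(\<Sum>x\<in>X. \<beta> x u) = (\<Sum>x\<in>X. \<beta> u x)"
      using that w_sym by (intro sum.cong) (auto simp: \<beta>_def)
    moreover have "\<beta> u u = 0" using w_irr that by (simp add: \<beta>_def)
    ultimately show ?thesis using that sum_\<beta>[of u X] by (simp add: sum.distrib)
  qed
  \<comment> \<open>For \<open>z\<close> in \<open>A\<close> the witness is \<open>z\<close> itself;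
    any other \<open>z\<close> without a witness would enlarge the maximum clique.\<close>
  have green_ex: "\<exists>x\<in>A. w x z = 0" if z: "z \<in> V" for z
  proof (rule ccontr)
    assume neg: "\<not> ?thesis"
    then have "z \<notin> A" using w_irr z by blast
    moreover have "clq (insert z A)"
      using A neg z w_sym by (auto simp: clq_def pairwise_insert subset_iff)
    ultimately show False using max[of "insert z A"] finA by simp
  qed
  \<comment> \<open>Replacing \<open>x\<close> by \<open>z\<close> gives another maximum clique,
    which by the choice of \<open>A\<close> has no fewer blue edges. If \<open>z\<close> lies in
    \<open>A\<close>, then \<open>z = x\<close>.\<close>
  have exchange: "bd x \<le> card {y \<in> A. blue z y}"
    if z: "z \<in> V" and x: "x \<in> A" "\<And>y. y \<in> A \<Longrightarrow> w y z = 0 \<Longrightarrow> y = x" for x z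
  proof (cases "z = x")
    case True
    then show ?thesis by (simp add: bd_def)
  next
    case False
    then have "z \<notin> A" using x(2)[of z] w_irr[OF z] by blast
    define X where "X = A - {x}"
    have X: "A = insert x X" "x \<notin> X" "X \<subseteq> V" "x \<in> V" "z \<notin> X" "finite X"
      using x AV \<open>z \<notin> A\<close> finA by (auto simp: X_def)
    have "\<And>y. y \<in> X \<Longrightarrow> w y z \<noteq> 0" using x(2) by (auto simp: X_def)
    then have "clq (insert z X)"
      using A X z w_sym by (auto simp: clq_def pairwise_insert subset_iff)
    moreover have "card (insert z X) = card A" using X by simp
    ultimately have "(\<Sum>x\<in>A. \<Sum>y\<in>A. \<beta> x y) \<le> (\<Sum>x\<in>insert z X. \<Sum>y\<in>insert z X. \<beta> x y)"
      using min A by simp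
    then have "card {y \<in> X. blue x y} \<le> card {y \<in> X. blue z y}"
      using sum_\<beta>_insert[of x X] sum_\<beta>_insert[of z X] X z by simp
    moreover have "{y \<in> A. blue x y} = {y \<in> X. blue x y}" using X(1) blue_irr by auto
    moreover have "card {y \<in> X. blue z y} \<le> card {y \<in> A. blue z y}"
      using finA by (intro card_mono) (auto simp: X_def)
    ultimately show ?thesis by (simp add: bd_def)
  qed
  define U T S where "U = {x \<in> A. bd x = 0}" and "T = {x \<in> A. bd x = 1}" and "S = {x \<in> A. bd x \<ge> 2}"
  text \<open>
    The weights make every vertex miss at least 4 of the maximal possible weighted degree into \<open>A\<close>,
    while their total is bounded by \<open>card A\<close> plus the size of a large blue-independent subset.
    If \<open>S\<close> is empty, the blue edges form a matching, and the larger weight on \<open>T\<close> would be wasteful.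
  \<close>
  define t :: real where "t = (if S = {} then 4 / 3 else 3 / 2)"
  define c :: "'a \<Rightarrow> real" where "c x = (if bd x = 0 then 2 else if bd x = 1 then t else 1)" for x
  have c_ge1: "c x \<ge> 1" for x by (auto simp: c_def t_def)
  have deficiency: "4 \<le> (\<Sum>x\<in>A. c x * (2 - real (w x z)))" if z: "z \<in> V" for z
  proof -
    have w_le: "real (w x z) \<le> 2" if "x \<in> A" for x
      using w012[OF subsetD[OF AV that] z] by auto
    have partial: "(\<Sum>x\<in>X. c x * (2 - real (w x z))) \<le> (\<Sum>x\<in>A. c x * (2 - real (w x z)))" if "X \<subseteq> A" for X
      using that finA c_ge1 w_le by (intro sum_mono2) (auto intro!: mult_nonneg_nonneg order_trans[OF _ c_ge1])
    obtain x where x: "x \<in> A" "w x z = 0" using green_ex[OF z] by blast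
    \<comment> \<open>Two vertices of \<open>A\<close> at weight 0 from \<open>z\<close> contribute
      at least 2 each. If \<open>x\<close> is the only one, \<open>exchange\<close> supplies at
      least \<open>bd x\<close> blue neighbours of \<open>z\<close> in \<open>A\<close>, each
      contributing its own weight \<open>c\<close>.\<close>
    show ?thesis
    proof (cases "\<exists>y\<in>A. y \<noteq> x \<and> w y z = 0")
      case True
      then obtain y where "y \<in> A" "y \<noteq> x" "w y z = 0" by blast
      then show ?thesis using partial[of "{x, y}"] x c_ge1[of x] c_ge1[of y] by simp
    next
      case False
      define D where "D = {y \<in> A. blue z y}"
      have D: "finite D" "D \<subseteq> A" using finA by (auto simp: D_def)
      have "bd x \<le> card D" unfolding D_def
        by (rule exchange[OF z x(1)]) (use False in blast)
      have D_blue: "w y z = 1" if "y \<in> D" for y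
        using that w_sym[of y z] by (simp add: D_def blue_def)
      have "x \<notin> D" using D_blue[of x] x(2) by auto
      then have ge: "2 * c x + (\<Sum>y\<in>D. c y) \<le> (\<Sum>x\<in>A. c x * (2 - real (w x z)))"
        using partial[of "insert x D"] D D_blue x by simp
      have "real (card D) \<le> (\<Sum>y\<in>D. c y)" using sum_mono[of D "\<lambda>_. 1" c] c_ge1 by simp
      \<comment> \<open>The weights are tuned to reach 4 each time: \<open>2 * 2\<close> for blue
        degree 0, and \<open>2 * 1 + 2\<close> for degree at least 2. For degree 1 it is
        \<open>2 * (3 / 2) + 1\<close>, or \<open>2 * (4 / 3) + 4 / 3\<close> when \<open>S\<close>
        is empty and so the blue neighbour also weighs at least \<open>4 / 3\<close>.\<close>
      consider "bd x = 0" | "bd x = 1" | "bd x \<ge> 2" by linarith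
      then show ?thesis
      proof cases
        case 2
        then have "D \<noteq> {}" using \<open>bd x \<le> card D\<close> by auto
        then obtain y where y: "y \<in> D" by blast
        have "c y \<le> (\<Sum>y\<in>D. c y)"
          using y D(1) c_ge1 by (intro member_le_sum) (auto intro: order_trans[OF _ c_ge1])
        moreover have "c y \<ge> t" if "S = {}"
        proof -
          have "bd y < 2" using that y D(2) by (force simp: S_def)
          then show ?thesis using that by (auto simp: c_def t_def)
        qed
        ultimately show ?thesis using ge 2 c_ge1[of y] by (auto simp: c_def t_def split: if_splits)
      qed (use ge \<open>real (card D) \<le> _\<close> \<open>bd x \<le> card D\<close> c_ge1[of x] in \<open>auto simp: c_def\<close>)
    qed
  qed
  have fin: "finite U" "finite T" "finite S" using finA by (auto simp: U_def T_def S_def)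
  have A_eq: "A = U \<union> T \<union> S" by (auto simp: U_def T_def S_def)
  have disj: "U \<inter> T = {}" "(U \<union> T) \<inter> S = {}" by (auto simp: U_def T_def S_def)
  have cardA: "card A = card U + card T + card S"
    using fin disj by (simp add: A_eq card_Un_disjoint)
  have sumc: "(\<Sum>x\<in>A. c x) = 2 * real (card U) + t * real (card T) + real (card S)"
  proof -
    have "(\<Sum>x\<in>U. c x) = (\<Sum>x\<in>U. 2)" "(\<Sum>x\<in>T. c x) = (\<Sum>x\<in>T. t)" "(\<Sum>x\<in>S. c x) = (\<Sum>x\<in>S. 1)"
      by (auto intro!: sum.cong simp: U_def T_def S_def c_def)
    then show ?thesis using fin disj by (simp add: A_eq sum.union_disjoint)
  qed
  have red: "card A + card I \<le> 2 * r" if I: "I \<subseteq> A" "pairwise (\<lambda>x y. \<not> blue x y) I" "card I > 0" for I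
  proof (rule F_family_free_clique_bound[OF G free r])
    have "w x y = 2" if "x \<in> I" "y \<in> I" "x \<noteq> y" for x y
    proof -
      have xy: "x \<in> A" "y \<in> A" "x \<in> V" "y \<in> V" using that I AV by auto
      moreover have "\<not> blue x y" using that I by (simp add: pairwise_def)
      ultimately show ?thesis
        using A_clq[OF xy(1,2) that(3)] w012[OF xy(3,4)] by (auto simp: blue_def)
    qed
    then show "pairwise (\<lambda>x y. w x y = 2) I" by (simp add: pairwise_def)
  qed (use A I in \<open>auto simp: clq_def\<close>)
  have total: "(\<Sum>x\<in>A. c x) \<le> 2 * real r - 2 / 3"
  proof (cases "S = {}")
    case True
    then have "\<And>x. x \<in> A \<Longrightarrow> card {y \<in> A. blue x y} \<le> 1" by (force simp: S_def bd_def)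
    then obtain I where I: "I \<subseteq> A" "pairwise (\<lambda>x y. \<not> blue x y) I"
      "card A + card {x \<in> A. \<forall>y\<in>A. \<not> blue x y} \<le> 2 * card I"
      using large_independent_set[where R = blue, OF finA blue_sym blue_irr] by blast
    have "{x \<in> A. \<forall>y\<in>A. \<not> blue x y} = U" using finA by (auto simp: U_def bd_def)
    with I large have "card A + card U \<le> 2 * card I" "card A + card I \<le> 2 * r"
      using red[of I] by auto
    \<comment> \<open>Eliminating \<open>card I\<close> gives
      \<open>4 * card U + 3 * card T \<le> 4 * r\<close>. Double this and subtract twice
      \<open>r + 1 \<le> card A\<close>; the assumption of a clique larger than \<open>r\<close>
      thus produces the summand 2.\<close>
    then have "6 * card U + 4 * card T + 2 \<le> 6 * r" using True cardA large by simp
    then have "6 * real (card U) + 4 * real (card T) + 2 \<le> 6 * real r" by linarith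
    then show ?thesis using True by (simp add: sumc t_def)
  next
    case False
    then obtain s where "s \<in> A" "bd s \<ge> 2" by (auto simp: S_def)
    then obtain I where I: "I \<subseteq> A" "pairwise (\<lambda>x y. \<not> blue x y) I" "2 * card U + card T + 2 \<le> 2 * card I"
      using independent_set_degree_ge_two[where R = blue and s = s, OF finA blue_sym blue_irr] unfolding U_def T_def bd_def by blast
    then have "card A + card I \<le> 2 * r" using red[of I] by auto
    \<comment> \<open>Here the sum of the weights is even at most \<open>2 * r - 1\<close>.\<close>
    then have "4 * card U + 3 * card T + 2 * card S + 2 \<le> 4 * r" using I cardA by linarith
    then have "4 * real (card U) + 3 * real (card T) + 2 * real (card S) + 2 \<le> 4 * real r" by linarith
    then show ?thesis using False by (simp add: sumc t_def)
  qed
  have pos: "3 * real r - 1 > 0" using r by simp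
  have each: "(\<Sum>z\<in>V. 2 - real (w x z)) < 6 / (3 * real r - 1) * real (card V)" if "x \<in> A" for x
  proof -
    have "(\<Sum>z\<in>V. 2 - real (w x z)) = 2 * real (card V) - real (degree (V, w) x)"
      by (simp add: sum_subtractf degree_def)
    moreover have "6 / (3 * real r - 1) = 2 - (6 * real r - 8) / (3 * real r - 1)"
      using pos by (simp add: field_simps)
    ultimately show ?thesis using deg[of x] that AV by (auto simp: left_diff_distrib)
  qed
  have "4 * real (card V) \<le> (\<Sum>z\<in>V. \<Sum>x\<in>A. c x * (2 - real (w x z)))"
    using sum_mono[OF deficiency, of V "\<lambda>z. z"] by (simp add: mult.commute)
  also have "\<dots> = (\<Sum>x\<in>A. c x * (\<Sum>z\<in>V. 2 - real (w x z)))"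
    by (subst sum.swap) (simp add: sum_distrib_left)
  also have "\<dots> < (\<Sum>x\<in>A. c x * (6 / (3 * real r - 1) * real (card V)))"
  proof (rule sum_strict_mono[OF finA])
    show "A \<noteq> {}" using large by auto
    show "c x * (\<Sum>z\<in>V. 2 - real (w x z)) < c x * (6 / (3 * real r - 1) * real (card V))" if "x \<in> A" for x
      using each[OF that] c_ge1[of x] by (intro mult_strict_left_mono) auto
  qed
  also have "\<dots> = (\<Sum>x\<in>A. c x) * (6 / (3 * real r - 1) * real (card V))"
    by (rule sum_distrib_right[symmetric])
  also have "\<dots> \<le> (2 * real r - 2 / 3) * (6 / (3 * real r - 1) * real (card V))"
    using total pos by (intro mult_right_mono) auto
  also have "\<dots> = 4 * real (card V)" using pos by (simp add: field_simps)
  finally show False by simp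
qed

section \<open>Colouring the graph of nongreen edges\<close>

theorem theorem1p7:
  fixes r n :: nat and V :: "'a set" and w :: "'a \<Rightarrow> 'a \<Rightarrow> nat"
  assumes "r \<ge> 2"
    and "coloured_graph (V, w)"
    and "card V = n" and "n \<ge> 1"
    and "family_free (V, w) (F_family (2 * r + 1))"
    and "real (min_degree (V, w)) > (6 * real r - 8) / (3 * real r - 1) * real n"
  shows "(\<exists>\<phi>. homomorphism \<phi> (V, w) (RK r)) \<and>
    (\<exists>W :: nat \<Rightarrow> 'a set.
       V = (\<Union>i\<in>{1..r}. W i) \<and>
       disjoint_family_on W {1..r} \<and>
       (\<forall>i\<in>{1..r}. \<forall>x\<in>W i. \<forall>y\<in>W i. w x y = 0))"
proof -
  note r = assms(1) and G = assms(2)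
  have finV: "finite V" and w_sym: "\<And>x y. x \<in> V \<Longrightarrow> y \<in> V \<Longrightarrow> w x y = w y x"
    and w_irr: "\<And>x. x \<in> V \<Longrightarrow> w x x = 0"
    and w012: "\<And>x y. x \<in> V \<Longrightarrow> y \<in> V \<Longrightarrow> w x y \<in> {0, 1, 2}"
    using G by (auto simp: coloured_graph_def)
  have w_le2: "w x y \<le> 2" if "x \<in> V" "y \<in> V" for x y
    using w012[OF that] by auto
  have deg: "(6 * real r - 8) / (3 * real r - 1) * real (card V) < real (degree (V, w) x)" if "x \<in> V" for x
  proof -
    have "min_degree (V, w) \<le> degree (V, w) x" using that finV by (simp add: min_degree_def)
    then show ?thesis using assms(3,6) by (auto intro: less_le_trans)
  qed
  define E where "E = {(x, y). x \<in> V \<and> y \<in> V \<and> w x y \<noteq> 0}"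
  have "\<exists>c::'a \<Rightarrow> nat. c ` V \<subseteq> {..<r} \<and> (\<forall>x\<in>V. \<forall>y\<in>V. (x, y) \<in> E \<longrightarrow> c x \<noteq> c y)"
  proof (rule Andrasfai_Erdos_Sos[OF finV])
    show "E \<subseteq> V \<times> V" "sym E" "irrefl E"
      using w_sym w_irr by (auto simp: E_def sym_def irrefl_def)
    show "r \<ge> 1" using r by simp
    show "card K \<le> r" if "K \<subseteq> V" "pairwise (\<lambda>x y. (x, y) \<in> E) K" for K
    proof (rule nongreen_clique_bound[OF G assms(5) _ deg])
      show "pairwise (\<lambda>x y. w x y \<noteq> 0) K" using that(2) by (simp add: pairwise_def E_def)
    qed (use r that in auto)
    show "(3 * real r - 4) / (3 * real r - 1) * real (card V) < real (card {v \<in> V. (u, v) \<in> E})"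
      if u: "u \<in> V" for u
    proof -
      have "degree (V, w) u \<le> (\<Sum>v\<in>V. if (u, v) \<in> E then 2 else 0)"
        unfolding degree_def fst_conv snd_conv using u w_le2 by (intro sum_mono) (auto simp: E_def)
      also have "\<dots> = 2 * card {v \<in> V. (u, v) \<in> E}" using finV by (simp add: sum.If_cases Int_def)
      finally have "real (degree (V, w) u) \<le> 2 * real (card {v \<in> V. (u, v) \<in> E})" by linarith
      moreover have "(6 * real r - 8) / (3 * real r - 1) = 2 * ((3 * real r - 4) / (3 * real r - 1))"
        by (simp add: right_diff_distrib)
      ultimately have "2 * ((3 * real r - 4) / (3 * real r - 1) * real (card V)) < 2 * real (card {v \<in> V. (u, v) \<in> E})"
        using less_le_trans[OF deg[OF u]] by (simp only: mult.assoc)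
      then show ?thesis by (simp only: mult_less_cancel_left_pos zero_less_numeral)
    qed
  qed
  then obtain c :: "'a \<Rightarrow> nat" where c: "c ` V \<subseteq> {..<r}"
    and "\<forall>x\<in>V. \<forall>y\<in>V. (x, y) \<in> E \<longrightarrow> c x \<noteq> c y"
    by metis
  then have proper: "w x y = 0" if "x \<in> V" "y \<in> V" "c x = c y" for x y
    using that by (auto simp: E_def)
  have "homomorphism c (V, w) (RK r)"
    using c proper w_le2 by (simp add: homomorphism_def RK_def)
  \<comment> \<open>The colours start at 0 and the classes at 1, hence \<open>Suc\<close>.\<close>
  moreover have "V = (\<Union>i\<in>{1..r}. {x \<in> V. Suc (c x) = i})" using c by auto
  moreover have "disjoint_family_on (\<lambda>i. {x \<in> V. Suc (c x) = i}) {1..r}"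
    by (auto simp: disjoint_family_on_def)
  moreover have "\<forall>i\<in>{1..r}. \<forall>x\<in>{x \<in> V. Suc (c x) = i}. \<forall>y\<in>{x \<in> V. Suc (c x) = i}. w x y = 0"
    using proper by auto
  ultimately show ?thesis by (intro conjI exI[of _ c] exI[of _ "\<lambda>i. {x \<in> V. Suc (c x) = i}"])
qed

end
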